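(* Let $\tau_t\in\mathbb{R}^p$ and $\sigma>0$. Under Gaussian differential privacy, i.e. $\hat\tau^{res}_t=\tau_t+e_t$ with $e_t\sim N(0,\sigma^2I)$ and $\hat T^{res}_{\chi^2,t}=\|\hat\tau^{res}_t\|_2^2$, one has $$\frac{\hat T^{res}_{\chi^2,t}}{\sigma^2}\sim\chi^2\Big(p,\frac{\|\tau_t\|_2^2}{\sigma^2}\Big).$$
   Context: $\chi^2(k,\mu)$ denotes the non-central chi-squared distribution with $k$ degrees of freedom and non-centrality parameter $\mu$. Here $\tau_t$ is a fixed (unperturbed, whitened) residual vector and the components of $e_t\in\mathbb{R}^p$ are independent $N(0,\sigma^2)$. *)

theory Defs
  imports "HOL-Probability.Probability"
begin

definition chi_square_density :: "nat \<Rightarrow> real \<Rightarrow> real" where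
  "chi_square_density k x =
     (if x > 0 then x powr (real k / 2 - 1) * exp (- x / 2) / (2 powr (real k / 2) * Gamma (real k / 2)) else 0)"

(* Density of the non-central chi-squared distribution with k >= 1 degrees of freedom and
   non-centrality mu >= 0: the central densities with k + 2 * j degrees of freedom, mixed
   over a Poisson(mu / 2) variable j.  The non-centrality is the sum of the squared means
   of the underlying unit-variance normals, not its half and not its square root. *)
definition noncentral_chi_square_density :: "nat \<Rightarrow> real \<Rightarrow> real \<Rightarrow> real" where
  "noncentral_chi_square_density k mu x =
     (\<Sum>j. exp (- mu / 2) * (mu / 2) ^ j / fact j * chi_square_density (k + 2 * j) x)"

end

(* The square of a N(m, 1) variable has density proportional to x^(-1/2) exp(-x/2) cosh(m sqrt x);
   expanding cosh gives, term by term, the Poisson mixture with one degree of freedom.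
   Central densities convolve by adding degrees of freedom (a Beta integral) and Poisson weights
   convolve by adding their means, so the noncentral densities form a two-parameter convolution
   semigroup.  Induction over the whitened coordinates (tau_i + e_i) / sigma then sums the squares. *)
theory Submission
  imports Defs
begin

section \<open>Rearranging double series, and the even power series of cosh\<close>

text \<open>Shifting row \<open>i\<close> right by \<open>i\<close> places, padded with zeros, turns
  diagonals into columns, and nonnegative sums may be exchanged without any summability condition.
  This is the Cauchy product regrouping needed to multiply two Poisson mixtures.\<close>

lemma suminf_diagonal_ennreal:
  fixes F :: "nat \<Rightarrow> nat \<Rightarrow> ennreal"
  shows "(\<Sum>i. \<Sum>j. F i j) = (\<Sum>n. \<Sum>i\<le>n. F i (n - i))"
proof -
  define G where "G = (\<lambda>i n. if i \<le> n then F i (n - i) else 0)"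
  have "(\<Sum>j. F i j) = (\<Sum>n. G i n)" for i
  proof -
    have "(\<Sum>n. G i n) = (\<Sum>j. G i (j + i)) + (\<Sum>n<i. G i n)"
      by (rule suminf_offset) simp
    then show ?thesis by (simp add: G_def)
  qed
  then have "(\<Sum>i. \<Sum>j. F i j) = (\<Sum>i. \<Sum>n. G i n)"
    by simp
  \<comment> \<open>Tonelli for series: the outer sum is read as an integral against counting
    measure.\<close>
  also have "\<dots> = (\<Sum>n. \<Sum>i. G i n)"
    using nn_integral_suminf[of "\<lambda>n i. G i n" "count_space UNIV"]
    by (simp add: nn_integral_count_space_nat)
  also have "\<dots> = (\<Sum>n. \<Sum>i\<le>n. F i (n - i))"
  proof -
    have "(\<Sum>i. G i n) = (\<Sum>i\<le>n. G i n)" for n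
      by (rule suminf_finite) (auto simp: G_def)
    then show ?thesis by (simp add: G_def)
  qed
  finally show ?thesis .
qed

lemma cosh_sums_even: "(\<lambda>j. z ^ (2 * j) / fact (2 * j)) sums cosh (z :: real)"
proof -
  have "(\<lambda>n. if even n then z ^ n /\<^sub>R fact n else 0) sums cosh z"
    by (rule cosh_converges)
  then have "(\<lambda>j. if even (2 * j) then z ^ (2 * j) /\<^sub>R fact (2 * j) else 0) sums cosh z"
    by (subst sums_mono_reindex[of "\<lambda>j. 2 * j"]) (auto simp: strict_mono_def elim!: evenE)
  then show ?thesis
    by (simp add: divide_inverse mult.commute)
qed

section \<open>Central chi-squared densities\<close>

lemma chi_square_density_nonneg [simp]: "0 \<le> chi_square_density k x"
  by (cases "k = 0") (auto simp: chi_square_density_def intro!: divide_nonneg_nonneg mult_nonneg_nonneg less_imp_le[OF Gamma_real_pos])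

lemma chi_square_density_nonpos [simp]: "x \<le> 0 \<Longrightarrow> chi_square_density k x = 0"
  by (simp add: chi_square_density_def)

lemma borel_measurable_chi_square_density [measurable]:
  "chi_square_density k \<in> borel_measurable borel"
  unfolding chi_square_density_def[abs_def] by measurable

text \<open>This is the functional equation of \<open>Gamma\<close> at \<open>k / 2\<close>.
  Iterating it yields both the growth bound behind summability and the closed form for odd degrees
  of freedom.\<close>

lemma chi_square_density_add_2:
  assumes "k > 0"
  shows "chi_square_density (k + 2) x = x / real k * chi_square_density k x"
proof (cases "x > 0")
  case True
  have "Gamma (real k / 2 + 1) = real k / 2 * Gamma (real k / 2)"
    using assms by (intro Gamma_plus1) (auto simp: nonpos_Ints_def)
  moreover have "x powr (real k / 2) = x powr (real k / 2 - 1) * x"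
    using True by (simp add: powr_diff)
  moreover have "(2::real) powr (real k / 2 + 1) = 2 powr (real k / 2) * 2"
    by (simp add: powr_add)
  moreover have "real (k + 2) / 2 = real k / 2 + 1" by simp
  ultimately show ?thesis
    using True assms unfolding chi_square_density_def
    by (simp add: field_simps)
qed (simp add: chi_square_density_def)

text \<open>The substitution \<open>y = x * t\<close> reduces the convolution to a Beta integral
  over the unit interval. Writing \<open>Beta\<close> through \<open>Gamma\<close> then cancels the
  two normalising constants and leaves the one for \<open>k + l\<close>.\<close>

lemma chi_square_density_convolution:
  assumes "k > 0" "l > 0"
  shows "(\<integral>\<^sup>+y. ennreal (chi_square_density k (x - y)) * ennreal (chi_square_density l y) \<partial>lborel)
         = ennreal (chi_square_density (k + l) x)"
proof (cases "x > 0")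
  case False
  then have "ennreal (chi_square_density k (x - y)) * ennreal (chi_square_density l y) = 0" for y
    by (cases "y \<le> 0") auto
  then show ?thesis using False by (simp del: mult_eq_0_iff)
next
  case True
  define a b where "a = real k / 2" and "b = real l / 2"
  \<comment> \<open>\<open>C\<close> gathers all that does not depend on \<open>t\<close> after the
    substitution; the exponentials combine because \<open>x - x * t\<close> and \<open>x * t\<close>
    add up to \<open>x\<close>.\<close>
  define C where "C = x powr (a - 1) * x powr (b - 1) * exp (- x / 2) / (2 powr (a + b) * (Gamma a * Gamma b))"
  have pos: "a > 0" "b > 0" using assms by (auto simp: a_def b_def)
  then have Gpos: "Gamma a > 0" "Gamma b > 0" "Gamma (a + b) > 0" by (auto intro: Gamma_real_pos)
  then have C: "C \<ge> 0" by (simp add: C_def)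
  have eq: "chi_square_density k (x - x * t) * chi_square_density l (x * t) =
      C * (t powr (b - 1) * (1 - t) powr (a - 1) * indicator {0..1} t)" for t
  proof (cases "0 < t \<and> t < 1")
    case t: True
    have *: "x - x * t = x * (1 - t)" by (simp add: algebra_simps)
    have e: "exp (- x / 2) = exp (- (x * (1 - t)) / 2) * exp (- (x * t) / 2)"
      unfolding exp_add[symmetric] by (simp add: field_simps)
    show ?thesis
      using t True Gpos unfolding * C_def e chi_square_density_def
      by (simp add: a_def[symmetric] b_def[symmetric] powr_mult powr_add) (simp add: divide_simps)
  next
    case False
    then have "x * t \<le> 0 \<or> x - x * t \<le> 0" "t \<le> 0 \<or> 1 \<le> t"
      using True by (auto simp: mult_le_0_iff not_less)
    then have "chi_square_density k (x - x * t) * chi_square_density l (x * t) = 0"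
      "t powr (b - 1) * (1 - t) powr (a - 1) * indicator {0..1} t = 0"
      by (auto simp: indicator_def)
    then show ?thesis by (simp only: mult_zero_right)
  qed
  have B: "(\<integral>\<^sup>+t. ennreal (t powr (b - 1) * (1 - t) powr (a - 1) * indicator {0..1} t) \<partial>lborel)
      = ennreal (Beta b a)"
    using nn_integral_has_integral_lebesgue[OF _ has_integral_Beta_real[OF pos(2) pos(1)]]
    by (simp add: mult_ac)
  have "(\<integral>\<^sup>+y. ennreal (chi_square_density k (x - y)) * ennreal (chi_square_density l y) \<partial>lborel)
      = ennreal x * (\<integral>\<^sup>+t. ennreal (chi_square_density k (x - x * t)) * ennreal (chi_square_density l (x * t)) \<partial>lborel)"
    using True by (subst nn_integral_real_affine[where c = x and t = 0]) auto
  also have "\<dots> = ennreal x * (\<integral>\<^sup>+t. ennreal C * ennreal (t powr (b - 1) * (1 - t) powr (a - 1) * indicator {0..1} t) \<partial>lborel)"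
    using C by (simp flip: ennreal_mult' ennreal_mult'' add: eq)
  also have "\<dots> = ennreal x * (ennreal C * ennreal (Beta b a))"
    unfolding B[symmetric] by (subst nn_integral_cmult) auto
  also have "\<dots> = ennreal (x * (C * Beta b a))"
    using C True by (simp add: ennreal_mult')
  also have "x * (C * Beta b a) = chi_square_density (k + l) x"
  proof -
    \<comment> \<open>The Jacobian \<open>x\<close> of the substitution raises the exponent from
      \<open>a + b - 2\<close> to \<open>a + b - 1\<close>.\<close>
    have p: "x * (x powr (a - 1) * x powr (b - 1)) = x powr (a + b - 1)"
      using True by (simp add: powr_diff powr_add field_simps)
    have "x * (C * Beta b a) = x * (x powr (a - 1) * x powr (b - 1)) * exp (- x / 2) / (2 powr (a + b) * Gamma (a + b))"
      using Gpos unfolding C_def Beta_def by (simp add: field_simps)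
    then show ?thesis
      unfolding p using True by (simp add: chi_square_density_def a_def b_def add_divide_distrib)
  qed
  finally show ?thesis .
qed

section \<open>Poisson mixtures of central densities\<close>

text \<open>The parameter is the non-centrality, which is twice the Poisson mean.\<close>

definition poisson_weight :: "real \<Rightarrow> nat \<Rightarrow> real" where
  "poisson_weight mu j = exp (- mu / 2) * (mu / 2) ^ j / fact j"

lemma poisson_weight_nonneg [simp]: "mu \<ge> 0 \<Longrightarrow> 0 \<le> poisson_weight mu j"
  by (simp add: poisson_weight_def)

text \<open>After the exponentials and \<open>fact n\<close> are pulled out, this is the binomial
  theorem for \<open>(a / 2 + b / 2) ^ n\<close>.\<close>

lemma poisson_weight_convolution:
  "(\<Sum>i\<le>n. poisson_weight a i * poisson_weight b (n - i)) = poisson_weight (a + b) n"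
proof -
  have "(\<Sum>i\<le>n. poisson_weight a i * poisson_weight b (n - i)) =
      exp (- (a + b) / 2) / fact n * (\<Sum>i\<le>n. real (n choose i) * (a / 2) ^ i * (b / 2) ^ (n - i))"
    unfolding sum_distrib_left
  proof (rule sum.cong)
    fix i assume "i \<in> {..n}"
    then have "real (n choose i) = fact n / (fact i * fact (n - i))"
      by (simp add: binomial_fact)
    moreover have "exp (- (a + b) / 2) = exp (- a / 2) * exp (- b / 2)"
      unfolding exp_add[symmetric] by (simp add: field_simps)
    ultimately show "poisson_weight a i * poisson_weight b (n - i) =
        exp (- (a + b) / 2) / fact n * (real (n choose i) * (a / 2) ^ i * (b / 2) ^ (n - i))"
      by (simp add: poisson_weight_def)
  qed simp
  also have "\<dots> = poisson_weight (a + b) n"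
    unfolding binomial_ring[symmetric] by (simp add: poisson_weight_def add_divide_distrib)
  finally show ?thesis .
qed

text \<open>Two more degrees of freedom multiply the density by \<open>x / (k + 2 * j)\<close>,
  which is at most \<open>x\<close>. The bound is crude, but the factorials in the Poisson weights
  absorb it.\<close>

lemma chi_square_density_le:
  assumes "k > 0" "x \<ge> 0"
  shows "chi_square_density (k + 2 * j) x \<le> chi_square_density k x * x ^ j"
proof (induction j)
  case (Suc j)
  have "chi_square_density (k + 2 * Suc j) x = x / real (k + 2 * j) * chi_square_density (k + 2 * j) x"
    using chi_square_density_add_2[of "k + 2 * j" x] assms by (simp add: add.assoc)
  also have "\<dots> \<le> x * (chi_square_density k x * x ^ j)"
  proof (rule mult_mono)
    have "1 \<le> real (k + 2 * j)" using assms by simp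
    then show "x / real (k + 2 * j) \<le> x"
      using assms by (simp add: divide_le_eq mult_left_mono mult_le_cancel_left1)
  qed (use Suc assms in auto)
  finally show ?case by (simp add: mult_ac)
qed simp

text \<open>The terms are dominated by a constant multiple of the exponential series at
  \<open>mu / 2 * x\<close>.\<close>

lemma summable_noncentral_chi_square_density:
  assumes "k > 0" "mu \<ge> 0"
  shows "summable (\<lambda>j. poisson_weight mu j * chi_square_density (k + 2 * j) x)"
proof (cases "x > 0")
  case True
  let ?g = "\<lambda>j. exp (- mu / 2) * chi_square_density k x * (inverse (fact j) * (mu / 2 * x) ^ j)"
  show ?thesis
  proof (rule summable_comparison_test')
    show "summable ?g"
      by (intro summable_mult summable_exp)
    show "norm (poisson_weight mu j * chi_square_density (k + 2 * j) x) \<le> ?g j" for j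
    proof -
      have "norm (poisson_weight mu j * chi_square_density (k + 2 * j) x)
          \<le> poisson_weight mu j * (chi_square_density k x * x ^ j)"
        using assms True by (auto intro!: mult_left_mono chi_square_density_le)
      also have "\<dots> = ?g j"
        by (simp add: poisson_weight_def power_mult_distrib field_simps)
      finally show ?thesis .
    qed
  qed
qed simp

lemma noncentral_chi_square_density_eq:
  "noncentral_chi_square_density k mu x =
    (\<Sum>j. poisson_weight mu j * chi_square_density (k + 2 * j) x)"
  by (simp only: noncentral_chi_square_density_def poisson_weight_def)

lemma noncentral_chi_square_density_nonneg:
  assumes "k > 0" "mu \<ge> 0"
  shows "0 \<le> noncentral_chi_square_density k mu x"
  unfolding noncentral_chi_square_density_eq
  using assms by (intro suminf_nonneg summable_noncentral_chi_square_density) simp_all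

text \<open>Summability carries the real series over to \<open>ennreal\<close>, where sums and
  integrals can be interchanged freely.\<close>

lemma ennreal_noncentral_chi_square_density:
  assumes "k > 0" "mu \<ge> 0"
  shows "ennreal (noncentral_chi_square_density k mu x) =
    (\<Sum>j. ennreal (poisson_weight mu j) * ennreal (chi_square_density (k + 2 * j) x))"
proof -
  have "ennreal (noncentral_chi_square_density k mu x) =
      (\<Sum>j. ennreal (poisson_weight mu j * chi_square_density (k + 2 * j) x))"
    unfolding noncentral_chi_square_density_eq using assms
    by (intro suminf_ennreal2[symmetric] summable_noncentral_chi_square_density) simp_all
  also have "\<dots> = (\<Sum>j. ennreal (poisson_weight mu j) * ennreal (chi_square_density (k + 2 * j) x))"
    using assms by (intro suminf_cong ennreal_mult) simp_all
  finally show ?thesis .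
qed

lemma borel_measurable_noncentral_chi_square_density [measurable]:
  "noncentral_chi_square_density k mu \<in> borel_measurable borel"
  unfolding noncentral_chi_square_density_def[abs_def] by measurable

text \<open>The central convolution of components \<open>i\<close> and \<open>j\<close> depends only
  on \<open>i + j\<close>. Collecting the double series along the diagonals \<open>n = i + j\<close>
  therefore leaves a convolution of Poisson weights as the coefficient of each central
  density.\<close>

lemma noncentral_chi_square_density_convolution:
  assumes "k > 0" "l > 0" "a \<ge> 0" "b \<ge> 0"
  shows "(\<integral>\<^sup>+y. ennreal (noncentral_chi_square_density k a (x - y)) *
                ennreal (noncentral_chi_square_density l b y) \<partial>lborel)
         = ennreal (noncentral_chi_square_density (k + l) (a + b) x)"
proof -
  let ?p = "\<lambda>i. ennreal (poisson_weight a i)" and ?q = "\<lambda>j. ennreal (poisson_weight b j)"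
  let ?c = "\<lambda>k x. ennreal (chi_square_density k x)"
  have "(\<integral>\<^sup>+y. ennreal (noncentral_chi_square_density k a (x - y)) *
                ennreal (noncentral_chi_square_density l b y) \<partial>lborel) =
      (\<integral>\<^sup>+y. (\<Sum>i. \<Sum>j. (?p i * ?q j) * (?c (k + 2 * i) (x - y) * ?c (l + 2 * j) y)) \<partial>lborel)"
  proof (rule nn_integral_cong)
    fix y
    have "(\<Sum>i. \<Sum>j. (?p i * ?q j) * (?c (k + 2 * i) (x - y) * ?c (l + 2 * j) y)) =
        (\<Sum>i. \<Sum>j. (?p i * ?c (k + 2 * i) (x - y)) * (?q j * ?c (l + 2 * j) y))"
      by (simp only: mult_ac)
    then show "ennreal (noncentral_chi_square_density k a (x - y)) *
        ennreal (noncentral_chi_square_density l b y) =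
        (\<Sum>i. \<Sum>j. (?p i * ?q j) * (?c (k + 2 * i) (x - y) * ?c (l + 2 * j) y))"
      using assms by (simp add: ennreal_noncentral_chi_square_density)
  qed
  also have "\<dots> = (\<Sum>i. \<Sum>j. (?p i * ?q j) *
      (\<integral>\<^sup>+y. ?c (k + 2 * i) (x - y) * ?c (l + 2 * j) y \<partial>lborel))"
    \<comment> \<open>The rules that factor constants out of series are disabled so that the
      integral reaches each single term.\<close>
    by (simp add: nn_integral_suminf nn_integral_cmult del: ennreal_suminf_cmult ennreal_suminf_multc)
  also have "\<dots> = (\<Sum>i. \<Sum>j. (?p i * ?q j) * ?c (k + l + 2 * (i + j)) x)"
    using assms by (simp add: chi_square_density_convolution add_ac distrib_left)
  also have "\<dots> = (\<Sum>n. \<Sum>i\<le>n. (?p i * ?q (n - i)) * ?c (k + l + 2 * n) x)"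
    by (subst suminf_diagonal_ennreal) (intro suminf_cong sum.cong, auto)
  also have "\<dots> = (\<Sum>n. ennreal (poisson_weight (a + b) n) * ?c (k + l + 2 * n) x)"
    using assms
    by (simp add: poisson_weight_convolution[symmetric] sum_ennreal[symmetric] ennreal_mult sum_distrib_right del: sum_ennreal)
  also have "\<dots> = ennreal (noncentral_chi_square_density (k + l) (a + b) x)"
    using assms by (simp add: ennreal_noncentral_chi_square_density)
  finally show ?thesis .
qed

section \<open>One degree of freedom\<close>

text \<open>The recurrence divides by \<open>1 * 3 * ... * (2 * j - 1)\<close>, which equals
  \<open>fact (2 * j) / (2 ^ j * fact j)\<close>. Written this way, the factor is ready to meet the
  Poisson weight and produce the series of cosh.\<close>

lemma chi_square_density_odd:
  "chi_square_density (1 + 2 * j) x = chi_square_density 1 x * (x ^ j * 2 ^ j * fact j / fact (2 * j))"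
proof (induction j)
  case (Suc j)
  have "chi_square_density (1 + 2 * Suc j) x = x / real (1 + 2 * j) * chi_square_density (1 + 2 * j) x"
    using chi_square_density_add_2[of "1 + 2 * j" x] by (simp add: add.commute)
  also have "\<dots> = chi_square_density 1 x * (x / real (1 + 2 * j) * (x ^ j * 2 ^ j * fact j / fact (2 * j)))"
    unfolding Suc by simp
  also have "x / real (1 + 2 * j) * (x ^ j * 2 ^ j * fact j / fact (2 * j)) =
      x ^ Suc j * 2 ^ Suc j * fact (Suc j) / fact (2 * Suc j)"
  proof -
    have "fact (2 * Suc j) = real (2 * Suc j) * (real (1 + 2 * j) * fact (2 * j))"
      by (simp add: algebra_simps)
    moreover have "real (1 + 2 * j) \<noteq> 0" "real (2 * Suc j) = 2 * real (Suc j)" "real (Suc j) \<noteq> 0"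
      by simp_all
    ultimately show ?thesis
      by (simp only: fact_Suc[of j] power_Suc) (simp add: divide_simps del: of_nat_Suc of_nat_add of_nat_mult)
  qed
  finally show ?case .
qed simp

text \<open>The factor \<open>2 * s\<close> is the Jacobian of \<open>x = s\<^sup>2\<close>, so the
  right side is the density of the absolute value of a normal variable with mean \<open>m\<close>
  and unit variance. It arises by splitting cosh into two exponentials and completing the square in
  each.\<close>

lemma noncentral_chi_square_density_1:
  assumes "s > 0"
  shows "noncentral_chi_square_density 1 (m\<^sup>2) (s\<^sup>2) * (2 * s) = normal_density m 1 s + normal_density (- m) 1 s"
proof -
  have c1: "chi_square_density 1 (s\<^sup>2) = exp (- s\<^sup>2 / 2) / (s * sqrt (2 * pi))"
  proof -
    have "(s\<^sup>2) powr (- (1 / 2)) = inverse s"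
      using assms by (simp add: powr_minus powr_half_sqrt)
    then show ?thesis
      using assms by (simp add: chi_square_density_def Gamma_one_half_real powr_half_sqrt real_sqrt_mult divide_simps)
  qed
  have "(\<lambda>j. exp (- m\<^sup>2 / 2) * chi_square_density 1 (s\<^sup>2) * ((m * s) ^ (2 * j) / fact (2 * j)))
      sums (exp (- m\<^sup>2 / 2) * chi_square_density 1 (s\<^sup>2) * cosh (m * s))"
    by (intro sums_mult cosh_sums_even)
  \<comment> \<open>The \<open>2 ^ j\<close> and \<open>fact j\<close> of the odd-degree formula
    cancel those of the Poisson weight, leaving the even powers of \<open>m * s\<close>.\<close>
  moreover have "exp (- m\<^sup>2 / 2) * chi_square_density 1 (s\<^sup>2) * ((m * s) ^ (2 * j) / fact (2 * j)) =
      exp (- m\<^sup>2 / 2) * (m\<^sup>2 / 2) ^ j / fact j * chi_square_density (1 + 2 * j) (s\<^sup>2)" for j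
    unfolding chi_square_density_odd
    by (simp add: power_mult power_mult_distrib power_divide)
  ultimately have "noncentral_chi_square_density 1 (m\<^sup>2) (s\<^sup>2) =
      exp (- m\<^sup>2 / 2) * chi_square_density 1 (s\<^sup>2) * cosh (m * s)"
    unfolding noncentral_chi_square_density_def by (simp add: sums_iff)
  then have "noncentral_chi_square_density 1 (m\<^sup>2) (s\<^sup>2) * (2 * s) =
      exp (- m\<^sup>2 / 2) * exp (- s\<^sup>2 / 2) * (exp (m * s) + exp (- (m * s))) / sqrt (2 * pi)"
    using assms unfolding c1 cosh_field_def by (simp add: field_simps)
  moreover have "exp (- m\<^sup>2 / 2) * exp (- s\<^sup>2 / 2) * exp (m * s) = exp (- (s - m)\<^sup>2 / 2)"
    "exp (- m\<^sup>2 / 2) * exp (- s\<^sup>2 / 2) * exp (- (m * s)) = exp (- (s + m)\<^sup>2 / 2)"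
    unfolding exp_add[symmetric] by (simp_all add: power2_eq_square field_simps)
  ultimately show ?thesis
    by (simp add: normal_density_def distrib_left add_divide_distrib)
qed

lemma nn_integral_noncentral_chi_square_density_1:
  assumes "b \<ge> 0"
  shows "(\<integral>\<^sup>+x. ennreal (noncentral_chi_square_density 1 (m\<^sup>2) x) * indicator {0..b\<^sup>2} x \<partial>lborel) =
    (\<integral>\<^sup>+x. ennreal (normal_density m 1 x) * indicator {- b..b} x \<partial>lborel)"
proof -
  \<comment> \<open>The origin is discarded because the pointwise identity needs
    \<open>s > 0\<close> and because \<open>{0..b}\<close> and \<open>{- b..0}\<close> overlap
    there.\<close>
  have ae: "AE x in lborel. x \<noteq> (0::real)"
    by (rule AE_lborel_singleton)
  \<comment> \<open>The lower limit is written \<open>0\<^sup>2\<close> to fit the substitution rule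
    for squaring on \<open>{0..b}\<close>.\<close>
  have "(\<integral>\<^sup>+x. ennreal (noncentral_chi_square_density 1 (m\<^sup>2) x * indicator {0\<^sup>2..b\<^sup>2} x) \<partial>lborel) =
    (\<integral>\<^sup>+s. ennreal (noncentral_chi_square_density 1 (m\<^sup>2) (s\<^sup>2) * (2 * s) * indicator {0..b} s) \<partial>lborel)"
    using assms
    by (intro nn_integral_substitution)
       (auto intro!: derivative_eq_intros continuous_intros simp: set_borel_measurable_def)
  also have "\<dots> = (\<integral>\<^sup>+s. ennreal (normal_density m 1 s) * indicator {0..b} s +
      ennreal (normal_density (- m) 1 s) * indicator {0..b} s \<partial>lborel)"
  proof (rule nn_integral_cong_AE, use ae in eventually_elim)
    fix s :: real assume "s \<noteq> 0"
    then show "ennreal (noncentral_chi_square_density 1 (m\<^sup>2) (s\<^sup>2) * (2 * s) * indicator {0..b} s) =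
      ennreal (normal_density m 1 s) * indicator {0..b} s + ennreal (normal_density (- m) 1 s) * indicator {0..b} s"
      by (cases "s \<in> {0..b}") (simp_all add: noncentral_chi_square_density_1 flip: ennreal_plus del: One_nat_def)
  qed
  also have "\<dots> = (\<integral>\<^sup>+s. ennreal (normal_density m 1 s) * indicator {0..b} s \<partial>lborel) +
      (\<integral>\<^sup>+s. ennreal (normal_density (- m) 1 s) * indicator {0..b} s \<partial>lborel)"
    by (intro nn_integral_add) auto
  \<comment> \<open>Reflection at the origin turns the mean \<open>- m\<close> into
    \<open>m\<close>, supplying the negative half of the interval.\<close>
  also have "(\<integral>\<^sup>+s. ennreal (normal_density (- m) 1 s) * indicator {0..b} s \<partial>lborel) =
      (\<integral>\<^sup>+s. ennreal (normal_density m 1 s) * indicator {- b..0} s \<partial>lborel)"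
    by (subst nn_integral_real_affine[where c = "-1" and t = 0])
       (auto intro!: nn_integral_cong simp: normal_density_def indicator_def power2_commute)
  also have "(\<integral>\<^sup>+s. ennreal (normal_density m 1 s) * indicator {0..b} s \<partial>lborel) + \<dots> =
      (\<integral>\<^sup>+s. ennreal (normal_density m 1 s) * indicator {0..b} s +
         ennreal (normal_density m 1 s) * indicator {- b..0} s \<partial>lborel)"
    by (intro nn_integral_add[symmetric]) auto
  also have "\<dots> = (\<integral>\<^sup>+x. ennreal (normal_density m 1 x) * indicator {- b..b} x \<partial>lborel)"
    using assms by (intro nn_integral_cong_AE, use ae in eventually_elim) (auto simp: indicator_def)
  finally show ?thesis
    by (simp add: ennreal_mult'' ennreal_indicator del: One_nat_def)
qed

section \<open>Squares of independent normal variables\<close>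

lemma noncentral_chi_square_density_nonpos [simp]:
  "x \<le> 0 \<Longrightarrow> noncentral_chi_square_density k mu x = 0"
  by (simp add: noncentral_chi_square_density_def)

text \<open>Distribution functions are compared: for \<open>a \<ge> 0\<close> the square is at most
  \<open>a\<close> exactly when \<open>X\<close> lies in \<open>{- sqrt a..sqrt a}\<close>, and for
  negative \<open>a\<close> both sides vanish.\<close>

lemma (in prob_space) distributed_normal_square:
  assumes X: "distributed M lborel X (normal_density m 1)"
  shows "distributed M lborel (\<lambda>\<omega>. (X \<omega>)\<^sup>2) (noncentral_chi_square_density 1 (m\<^sup>2))"
proof (rule distributedI_borel_atMost)
  have [measurable]: "X \<in> borel_measurable M"
    using distributed_measurable[OF X] by simp
  show "(\<lambda>\<omega>. (X \<omega>)\<^sup>2) \<in> borel_measurable M"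
    by measurable
  show "AE x in lborel. 0 \<le> noncentral_chi_square_density 1 (m\<^sup>2) x"
    by (simp add: noncentral_chi_square_density_nonneg)
  fix a :: real
  show eq: "emeasure M {\<omega> \<in> space M. (X \<omega>)\<^sup>2 \<le> a} = ennreal (prob {\<omega> \<in> space M. (X \<omega>)\<^sup>2 \<le> a})"
    by (rule emeasure_eq_measure)
  show "(\<integral>\<^sup>+x. ennreal (noncentral_chi_square_density 1 (m\<^sup>2) x * indicator {..a} x) \<partial>lborel) =
    ennreal (prob {\<omega> \<in> space M. (X \<omega>)\<^sup>2 \<le> a})"
  proof (cases "a \<ge> 0")
    case True
    have iff: "y\<^sup>2 \<le> a \<longleftrightarrow> - sqrt a \<le> y \<and> y \<le> sqrt a" for y
      using real_sqrt_le_iff[of "y\<^sup>2" a] by (auto simp: abs_le_iff minus_le_iff simp del: real_sqrt_le_iff)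
    have "(\<integral>\<^sup>+x. ennreal (noncentral_chi_square_density 1 (m\<^sup>2) x * indicator {..a} x) \<partial>lborel) =
      (\<integral>\<^sup>+x. ennreal (noncentral_chi_square_density 1 (m\<^sup>2) x) * indicator {0..(sqrt a)\<^sup>2} x \<partial>lborel)"
      using True by (intro nn_integral_cong) (auto simp: indicator_def)
    also have "\<dots> = (\<integral>\<^sup>+x. ennreal (normal_density m 1 x) * indicator {- sqrt a..sqrt a} x \<partial>lborel)"
      using True by (intro nn_integral_noncentral_chi_square_density_1) simp
    also have "\<dots> = emeasure M (X -` {- sqrt a..sqrt a} \<inter> space M)"
      by (rule distributed_emeasure[OF X, symmetric]) simp
    also have "X -` {- sqrt a..sqrt a} \<inter> space M = {\<omega> \<in> space M. (X \<omega>)\<^sup>2 \<le> a}"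
      unfolding iff by auto
    finally show ?thesis by (simp add: eq)
  next
    case False
    then have "{\<omega> \<in> space M. (X \<omega>)\<^sup>2 \<le> a} = {}"
      by (auto simp: not_le intro: less_le_trans)
    moreover have "(\<integral>\<^sup>+x. ennreal (noncentral_chi_square_density 1 (m\<^sup>2) x * indicator {..a} x) \<partial>lborel) =
      (\<integral>\<^sup>+x. 0 \<partial>(lborel :: real measure))"
      using False by (intro nn_integral_cong) (auto simp: indicator_def)
    ultimately show ?thesis by (simp only: nn_integral_const mult_zero_left measure_empty ennreal_0)
  qed
qed measurable

text \<open>Each new independent square contributes one degree of freedom and its squared mean, by
  the convolution law. The induction starts at a singleton, since the empty sum is a point mass
  without a density.\<close>

lemma (in prob_space) distributed_sum_squares_normal:
  assumes "finite I" "I \<noteq> {}" "indep_vars (\<lambda>i. borel) X I"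
    and "\<And>i. i \<in> I \<Longrightarrow> distributed M lborel (X i) (normal_density (m i) 1)"
  shows "distributed M lborel (\<lambda>\<omega>. \<Sum>i\<in>I. (X i \<omega>)\<^sup>2)
    (noncentral_chi_square_density (card I) (\<Sum>i\<in>I. (m i)\<^sup>2))"
  using assms
proof (induction I rule: finite_ne_induct)
  case (singleton i)
  then show ?case using distributed_normal_square[of "X i" "m i"] by simp
next
  case (insert i I)
  have "indep_vars (\<lambda>_. borel) (\<lambda>i \<omega>. (X i \<omega>)\<^sup>2) (insert i I)"
    using insert.prems(1) by (rule indep_vars_compose2) simp
  then have "indep_var borel (\<lambda>\<omega>. (X i \<omega>)\<^sup>2) borel (\<lambda>\<omega>. \<Sum>j\<in>I. (X j \<omega>)\<^sup>2)"
    using insert.hyps by (intro indep_vars_sum)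
  moreover have "distributed M lborel (\<lambda>\<omega>. (X i \<omega>)\<^sup>2) (noncentral_chi_square_density 1 ((m i)\<^sup>2))"
    using insert.prems by (intro distributed_normal_square) simp
  moreover have "distributed M lborel (\<lambda>\<omega>. \<Sum>j\<in>I. (X j \<omega>)\<^sup>2)
      (noncentral_chi_square_density (card I) (\<Sum>j\<in>I. (m j)\<^sup>2))"
    using insert.prems indep_vars_subset[OF insert.prems(1)] by (intro insert.IH) auto
  ultimately have "distributed M lborel (\<lambda>\<omega>. (X i \<omega>)\<^sup>2 + (\<Sum>j\<in>I. (X j \<omega>)\<^sup>2))
    (\<lambda>x. \<integral>\<^sup>+y. ennreal (noncentral_chi_square_density 1 ((m i)\<^sup>2) (x - y)) *
      ennreal (noncentral_chi_square_density (card I) (\<Sum>j\<in>I. (m j)\<^sup>2) y) \<partial>lborel)"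
    by (rule distributed_convolution)
  then show ?case
    using insert.hyps
    by (subst (asm) noncentral_chi_square_density_convolution) (auto simp: card_gt_0_iff sum_nonneg)
qed

theorem lemma4p3:
  fixes M :: "'a measure"
    and tau :: "real ^ 'p"
    and sigma :: real
    and e tau_hat :: "'a \<Rightarrow> real ^ 'p"
    and T_hat :: "'a \<Rightarrow> real"
  assumes "prob_space M"
    and "sigma > 0"
    and "prob_space.indep_vars M (\<lambda>i. borel) (\<lambda>i \<omega>. e \<omega> $ i) UNIV"
    and "\<And>i. distributed M lborel (\<lambda>\<omega>. e \<omega> $ i) (normal_density 0 sigma)"
    and "\<And>\<omega>. tau_hat \<omega> = tau + e \<omega>"
    and "\<And>\<omega>. T_hat \<omega> = (norm (tau_hat \<omega>))\<^sup>2"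
  shows "distributed M lborel (\<lambda>\<omega>. T_hat \<omega> / sigma\<^sup>2)
           (noncentral_chi_square_density CARD('p) ((norm tau)\<^sup>2 / sigma\<^sup>2))"
proof -
  interpret prob_space M by fact
  \<comment> \<open>The whitened coordinates, in the affine form that
    \<open>normal_density_affine\<close> expects; scaling by \<open>1 / sigma\<close> gives unit
    variance.\<close>
  let ?X = "\<lambda>i \<omega>. tau $ i / sigma + 1 / sigma * e \<omega> $ i"
  \<comment> \<open>Needed for the perturbed vector, to identify the statistic, and for
    \<open>tau\<close>, to identify the non-centrality.\<close>
  have norm_scaled: "(norm v)\<^sup>2 / sigma\<^sup>2 = (\<Sum>i\<in>UNIV. (v $ i / sigma)\<^sup>2)" for v :: "real ^ 'p"
    by (simp add: norm_vec_def L2_set_def sum_nonneg power_divide sum_divide_distrib)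
  have "indep_vars (\<lambda>i. borel) ?X UNIV"
    using assms(3) by (rule indep_vars_compose2) simp
  moreover have "distributed M lborel (?X i) (normal_density (tau $ i / sigma) 1)" for i
    using normal_density_affine[OF assms(4), of "1 / sigma" "tau $ i / sigma" i] assms(2) by simp
  ultimately have "distributed M lborel (\<lambda>\<omega>. \<Sum>i\<in>UNIV. (?X i \<omega>)\<^sup>2)
      (noncentral_chi_square_density CARD('p) (\<Sum>i\<in>UNIV. (tau $ i / sigma)\<^sup>2))"
    by (intro distributed_sum_squares_normal) auto
  moreover have "T_hat \<omega> / sigma\<^sup>2 = (\<Sum>i\<in>UNIV. (?X i \<omega>)\<^sup>2)" for \<omega>
    unfolding assms(5,6) norm_scaled by (simp add: add_divide_distrib)
  ultimately show ?thesis
    by (simp add: norm_scaled)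
qed

end
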